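(* For every comeager set $G\subseteq \omega^\omega\times\omega^\omega$ there exist a Miller tree $M\subseteq\omega^{<\omega}$ and a uniformly perfect tree $P\subseteq M$ such that $[P]\times[M]\subseteq G\cup\Delta$, where $\Delta=\{(x,x):x\in\omega^\omega\}$.
   Context: $\omega^\omega$ is the Baire space with its usual (product of discrete) topology, and $\omega^{<\omega}=\bigcup_{n\in\omega}\omega^n$. A tree is a nonempty set $T\subseteq\omega^{<\omega}$ closed under initial segments: $\sigma\restriction n\in T$ for all $\sigma\in T$, $n\in\omega$. Its body is $[T]=\{x\in\omega^\omega:(\forall n)\ x\restriction n\in T\}$. For $\sigma\in T$ let $\mathrm{succ}_T(\sigma)=\{a\in\omega:\sigma^\frown a\in T\}$, let $\mathrm{split}(T)=\{\sigma\in T:|\mathrm{succ}_T(\sigma)|\ge 2\}$ and $\omega\text{-}\mathrm{split}(T)=\{\sigma\in T:|\mathrm{succ}_T(\sigma)|=\omega\}$. A tree $T$ is a Miller (superperfect) tree if for every $\sigma\in T$ there is $\tau\in\omega\text{-}\mathrm{split}(T)$ with $\sigma\subseteq\tau$. A tree $T$ is perfect if for every $\sigma\in T$ there is $\tau\in\mathrm{split}(T)$ with $\sigma\subseteq\tau$. A perfect tree $T$ is uniformly perfect if for every $n\in\omega$ either $\omega^n\cap T\subseteq\mathrm{split}(T)$ or $\omega^n\cap\mathrm{split}(T)=\emptyset$. *)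

theory Defs
  imports "HOL-Analysis.Analysis" "HOL-Library.Sublist"
begin

text \<open>
  Baire space is the type \<open>nat \<Rightarrow> nat\<close>: the type class instances of the library give it the product
  topology of the discrete topology on \<open>nat\<close>. Finite sequences are lists of natural numbers.
\<close>

definition nowhere_dense :: "'a::topological_space set \<Rightarrow> bool" where
  "nowhere_dense S \<longleftrightarrow> interior (closure S) = {}"

definition meager :: "'a::topological_space set \<Rightarrow> bool" where
  "meager S \<longleftrightarrow> (\<exists>N :: nat \<Rightarrow> 'a set. (\<forall>n. nowhere_dense (N n)) \<and> S = (\<Union>n. N n))"

definition comeager :: "'a::topological_space set \<Rightarrow> bool" where
  "comeager S \<longleftrightarrow> meager (- S)"

definition is_tree :: "nat list set \<Rightarrow> bool" where
  "is_tree T \<longleftrightarrow> T \<noteq> {} \<and> (\<forall>\<sigma>\<in>T. \<forall>n. take n \<sigma> \<in> T)"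

definition restr :: "(nat \<Rightarrow> nat) \<Rightarrow> nat \<Rightarrow> nat list" where
  "restr x n = map x [0..<n]"

definition body :: "nat list set \<Rightarrow> (nat \<Rightarrow> nat) set" where
  "body T = {x. \<forall>n. restr x n \<in> T}"

definition succs :: "nat list set \<Rightarrow> nat list \<Rightarrow> nat set" where
  "succs T \<sigma> = {a. \<sigma> @ [a] \<in> T}"

text \<open>As \<open>card\<close> is 0 on infinite sets, having at least two successors needs the infinite case
  separately. A set of natural numbers has cardinality \<open>\<omega>\<close> iff it is infinite.\<close>

definition split_nodes :: "nat list set \<Rightarrow> nat list set" where
  "split_nodes T = {\<sigma>\<in>T. infinite (succs T \<sigma>) \<or> card (succs T \<sigma>) \<ge> 2}"

definition omega_split_nodes :: "nat list set \<Rightarrow> nat list set" where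
  "omega_split_nodes T = {\<sigma>\<in>T. infinite (succs T \<sigma>)}"

definition miller_tree :: "nat list set \<Rightarrow> bool" where
  "miller_tree T \<longleftrightarrow> is_tree T \<and> (\<forall>\<sigma>\<in>T. \<exists>\<tau>\<in>omega_split_nodes T. prefix \<sigma> \<tau>)"

definition perfect_tree :: "nat list set \<Rightarrow> bool" where
  "perfect_tree T \<longleftrightarrow> is_tree T \<and> (\<forall>\<sigma>\<in>T. \<exists>\<tau>\<in>split_nodes T. prefix \<sigma> \<tau>)"

definition uniformly_perfect_tree :: "nat list set \<Rightarrow> bool" where
  "uniformly_perfect_tree T \<longleftrightarrow> perfect_tree T \<and>
     (\<forall>n. {\<sigma>. length \<sigma> = n} \<inter> T \<subseteq> split_nodes T \<or>
          {\<sigma>. length \<sigma> = n} \<inter> split_nodes T = {})"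

end

theory Submission
  imports Defs
begin

text \<open>
  The proof is a fusion. The complement of \<open>G\<close> is a countable union of nowhere dense sets \<open>N i\<close>.
  Finite sets \<open>spine n \<subseteq> nodes n\<close> of sequences are built in stages: \<open>nodes n\<close> holds the nodes
  of \<open>M\<close> that are going to split infinitely, and \<open>spine n\<close> is a whole level of \<open>P\<close>. At stage \<open>n\<close>
  every node receives one successor with a label not used before, every node of the spine receives
  a second one, and all these finitely many one-step extensions are lengthened to a common length
  in such a way that any two different ones span a box disjoint from \<open>N 0, \<dots>, N n\<close>
  (\<open>uniform_extension\<close>). Their results are the new nodes; those above the old spine, two for each
  of its members, form the new spine.

  A node acquires a successor at every later stage, so the downward closure \<open>M\<close> of the nodes is a
  Miller tree. All members of a spine have the same length and split into exactly two, so the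
  downward closure \<open>P\<close> of the spines is uniformly perfect.

  Let \<open>x \<in> [P]\<close> and \<open>y \<in> [M]\<close> differ. The key point is that \<open>y\<close> runs through arbitrarily long
  nodes (\<open>body_miller_passes_long_nodes\<close>). Take such a node \<open>r\<close>, created at stage \<open>n\<close>, that is long
  enough to disagree with \<open>x\<close>. The spine created at stage \<open>n\<close> has the same length as \<open>r\<close>, and \<open>x\<close>
  runs through one of its members, which is a node other than \<open>r\<close>. Hence \<open>(x, y)\<close> lies in a box made
  at stage \<open>n\<close>, outside \<open>N 0, \<dots>, N n\<close> (\<open>separated_late\<close>); as \<open>n\<close> is arbitrarily large,
  \<open>(x, y) \<in> G\<close>. The asymmetry between \<open>P\<close> and \<open>M\<close> is that every branch of \<open>P\<close> takes part in every
  stage, whereas a branch of \<open>M\<close> takes part only in those at which its nodes are created: two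
  branches of \<open>M\<close> may have no late stage in common.
\<close>

section \<open>Cylinders of Baire space\<close>

definition cyl :: "nat list \<Rightarrow> (nat \<Rightarrow> nat) set" where
  "cyl s = {x. restr x (length s) = s}"

lemma length_restr [simp]: "length (restr x n) = n"
  by (simp add: restr_def)

lemma nth_restr [simp]: "i < n \<Longrightarrow> restr x n ! i = x i"
  by (simp add: restr_def)

lemma take_restr: "take k (restr x n) = restr x (min k n)"
  by (simp add: restr_def take_map min_def)

lemma mem_cyl_iff: "x \<in> cyl s \<longleftrightarrow> (\<forall>i<length s. x i = s ! i)"
  by (auto simp: cyl_def list_eq_iff_nth_eq)

lemma mem_cyl_restr: "x \<in> cyl (restr x n)"
  by (simp add: mem_cyl_iff)

lemma cyl_antimono: "prefix s t \<Longrightarrow> cyl t \<subseteq> cyl s"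
  by (auto simp: mem_cyl_iff prefix_def nth_append)

lemma cyl_nonempty: "cyl s \<noteq> {}"
proof -
  have "(\<lambda>i. s ! i) \<in> cyl s" by (simp add: mem_cyl_iff)
  then show ?thesis by blast
qed

lemma prefix_restr:
  assumes "x \<in> cyl s" "length s \<le> n"
  shows "prefix s (restr x n)"
proof -
  have "take (length s) (restr x n) = s"
    using assms by (simp add: take_restr cyl_def min_def)
  then show ?thesis by (metis take_is_prefix)
qed

lemma open_cyl: "open (cyl s)"
proof -
  have "cyl s = (\<Inter>i<length s. (\<lambda>x. x i) -` {s ! i})"
    by (auto simp: mem_cyl_iff)
  moreover have "open ((\<lambda>x::nat \<Rightarrow> nat. x i) -` {s ! i})" for i
    by (intro open_vimage continuous_on_product_coordinates) (simp add: open_discrete)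
  ultimately show ?thesis by (auto intro!: open_INT)
qed

lemma open_contains_cyl:
  assumes "open U" "x \<in> U"
  obtains n where "cyl (restr x n) \<subseteq> U"
proof -
  have "openin (product_topology (\<lambda>i::nat. euclidean) UNIV) U"
    using assms(1) by (simp add: open_fun_def)
  from product_topology_open_contains_basis[OF this assms(2)]
  obtain X where X: "x \<in> Pi\<^sub>E UNIV X" "finite {i. X i \<noteq> UNIV}" "Pi\<^sub>E UNIV X \<subseteq> U"
    by auto
  obtain n where n: "\<And>i. X i \<noteq> UNIV \<Longrightarrow> i < n"
    using X(2) unfolding finite_nat_set_iff_bounded by blast
  have "y \<in> Pi\<^sub>E UNIV X" if "y \<in> cyl (restr x n)" for y
  proof -
    have "y i \<in> X i" for i
      using that n[of i] X(1) by (cases "X i = UNIV") (auto simp: mem_cyl_iff PiE_iff)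
    then show ?thesis by (simp add: PiE_iff)
  qed
  then have "cyl (restr x n) \<subseteq> U" using X(3) by blast
  then show ?thesis by (rule that)
qed

section \<open>Extending finitely many nodes off a nowhere dense set\<close>

text \<open>
  The box \<open>cyl s \<times> cyl t\<close> is open and nonempty, so it contains a point off the closure of \<open>N\<close>;
  a whole box around that point then misses \<open>N\<close>.
\<close>

lemma avoid_nowhere_dense:
  assumes "nowhere_dense N"
  obtains s' t' where "prefix s s'" "prefix t t'" "cyl s' \<times> cyl t' \<inter> N = {}"
proof -
  have "\<not> cyl s \<times> cyl t \<subseteq> closure N"
  proof
    assume "cyl s \<times> cyl t \<subseteq> closure N"
    then have "cyl s \<times> cyl t \<subseteq> interior (closure N)"
      by (intro interior_maximal open_Times open_cyl)
    then show False
      using assms cyl_nonempty[of s] cyl_nonempty[of t] by (auto simp: nowhere_dense_def)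
  qed
  then obtain x y where xy: "x \<in> cyl s" "y \<in> cyl t" "(x, y) \<in> - closure N" by blast
  obtain A B where AB: "open A" "open B" "x \<in> A" "y \<in> B" "A \<times> B \<subseteq> - closure N"
    by (rule open_prod_elim[of "- closure N" "(x, y)"]) (use xy(3) in auto)
  obtain m where m: "cyl (restr x m) \<subseteq> A" by (rule open_contains_cyl[OF AB(1,3)])
  obtain n where n: "cyl (restr y n) \<subseteq> B" by (rule open_contains_cyl[OF AB(2,4)])
  define s' where "s' = restr x (max m (length s))"
  define t' where "t' = restr y (max n (length t))"
  have "prefix s s'" "prefix t t'"
    using xy by (simp_all add: s'_def t'_def prefix_restr)
  moreover have "cyl s' \<subseteq> A"
    using m cyl_antimono[OF prefix_restr[OF mem_cyl_restr, where n = "max m (length s)"], of x m]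
    by (simp add: s'_def)
  moreover have "cyl t' \<subseteq> B"
    using n cyl_antimono[OF prefix_restr[OF mem_cyl_restr, where n = "max n (length t)"], of y n]
    by (simp add: t'_def)
  then have "cyl s' \<times> cyl t' \<inter> N = {}"
    using \<open>cyl s' \<subseteq> A\<close> AB(5) closure_subset[of N] by blast
  ultimately show ?thesis using that by simp
qed

text \<open>
  The requirements are met one after the other: lengthening sequences only shrinks their
  cylinders, so a requirement once met stays met. As \<open>s \<noteq> t\<close>, the two may be lengthened
  independently, even when one is a prefix of the other.
\<close>

lemma avoid_finitely_many:
  assumes "finite Q" and "\<And>N s t. (N, s, t) \<in> Q \<Longrightarrow> nowhere_dense N \<and> s \<noteq> t"
  shows "\<exists>e. (\<forall>v. prefix v (e v)) \<and> (\<forall>(N, s, t)\<in>Q. cyl (e s) \<times> cyl (e t) \<inter> N = {})"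
  using assms
proof (induction Q rule: finite_induct)
  case empty
  then show ?case by (intro exI[of _ id]) auto
next
  case (insert q Q)
  obtain N s t where q: "q = (N, s, t)" by (metis prod_cases3)
  have "\<exists>e. (\<forall>v. prefix v (e v)) \<and> (\<forall>(N, s, t)\<in>Q. cyl (e s) \<times> cyl (e t) \<inter> N = {})"
    by (rule insert.IH) (use insert.prems in blast)
  then obtain e where e: "\<forall>v. prefix v (e v)"
      "\<forall>(N, s, t)\<in>Q. cyl (e s) \<times> cyl (e t) \<inter> N = {}"
    by blast
  have st: "nowhere_dense N" "s \<noteq> t" using insert.prems q by auto
  obtain s' t' where st': "prefix (e s) s'" "prefix (e t) t'" "cyl s' \<times> cyl t' \<inter> N = {}"
    by (rule avoid_nowhere_dense[OF st(1)])
  define e' where "e' = e(s := s', t := t')"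
  have ext: "prefix (e v) (e' v)" for v using st' by (simp add: e'_def)
  have "prefix v (e' v)" for v using e(1) ext prefix_order.trans by blast
  moreover have "case p of (N, s, t) \<Rightarrow> cyl (e' s) \<times> cyl (e' t) \<inter> N = {}" if "p \<in> Q" for p
  proof -
    obtain N2 s2 t2 where p: "p = (N2, s2, t2)" by (metis prod_cases3)
    then show ?thesis
      using bspec[OF e(2) that] cyl_antimono[OF ext[of s2]] cyl_antimono[OF ext[of t2]] by auto
  qed
  moreover have "cyl (e' s) \<times> cyl (e' t) \<inter> N = {}"
    using st' st by (simp add: e'_def)
  ultimately show ?case by (intro exI[of _ e']) (simp add: q)
qed

text \<open>
  The common length comes for free, by padding with zeros. It is what makes the levels of the
  perfect tree split all at once, and what lets the length of a node reveal its stage.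
\<close>

lemma uniform_extension:
  assumes "finite V" "finite \<N>" "\<And>N. N \<in> \<N> \<Longrightarrow> nowhere_dense N"
  shows "\<exists>e L. (\<forall>v\<in>V. prefix v (e v) \<and> length (e v) = L) \<and>
    (\<forall>s\<in>V. \<forall>t\<in>V. \<forall>N\<in>\<N>. s \<noteq> t \<longrightarrow> cyl (e s) \<times> cyl (e t) \<inter> N = {})"
proof -
  let ?Q = "{(N, s, t) \<in> \<N> \<times> V \<times> V. s \<noteq> t}"
  have "finite ?Q"
    by (rule finite_subset[of _ "\<N> \<times> V \<times> V"]) (use assms in auto)
  then have "\<exists>e. (\<forall>v. prefix v (e v)) \<and> (\<forall>(N, s, t)\<in>?Q. cyl (e s) \<times> cyl (e t) \<inter> N = {})"
    by (rule avoid_finitely_many) (use assms(3) in auto)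
  then obtain e where e: "\<forall>v. prefix v (e v)"
      "\<forall>(N, s, t)\<in>?Q. cyl (e s) \<times> cyl (e t) \<inter> N = {}"
    by blast
  define L where "L = (\<Sum>v\<in>V. length (e v))"
  define e' where "e' v = e v @ replicate (L - length (e v)) 0" for v
  have pre: "prefix (e v) (e' v)" for v by (simp add: e'_def)
  have "length (e v) \<le> L" if "v \<in> V" for v
    unfolding L_def using assms(1) that by (intro member_le_sum) auto
  then have "length (e' v) = L" if "v \<in> V" for v using that by (simp add: e'_def)
  moreover have "prefix v (e' v)" for v using e(1) pre prefix_order.trans by blast
  moreover have "cyl (e' s) \<times> cyl (e' t) \<inter> N = {}"
    if "s \<in> V" "t \<in> V" "N \<in> \<N>" "s \<noteq> t" for s t N
    using bspec[OF e(2), of "(N, s, t)"] that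
      cyl_antimono[OF pre[of s]] cyl_antimono[OF pre[of t]] by auto
  ultimately show ?thesis by (intro exI[of _ e'] exI[of _ L] conjI ballI impI)
qed

section \<open>The stages of the fusion\<close>

text \<open>
  Labels \<open>2 * n\<close> and \<open>2 * n + 1\<close> are reserved for stage \<open>n\<close>. Thus a node never receives the same
  successor twice, and the stage at which a successor was added can be read off its label as
  \<open>b div 2\<close>.
\<close>

definition sprouts :: "nat \<Rightarrow> nat list set \<Rightarrow> nat list set \<Rightarrow> nat list set" where
  "sprouts n A B = (\<lambda>t. t @ [2 * n]) ` B \<union> (\<lambda>p. p @ [2 * n + 1]) ` A"

lemma finite_sprouts: "finite A \<Longrightarrow> finite B \<Longrightarrow> finite (sprouts n A B)"
  by (simp add: sprouts_def)

lemma sprouts_mono: "B \<subseteq> B' \<Longrightarrow> sprouts n A B \<subseteq> sprouts n A B'"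
  by (auto simp: sprouts_def)

lemma sproutsE:
  assumes "v \<in> sprouts n A B" "A \<subseteq> B"
  obtains u b where "v = u @ [b]" "u \<in> B" "b div 2 = n"
proof -
  from assms(1) consider t where "t \<in> B" "v = t @ [2 * n]"
    | p where "p \<in> A" "v = p @ [2 * n + 1]"
    by (auto simp: sprouts_def)
  then show ?thesis
  proof cases
    case (1 t)
    then show ?thesis by (intro that) auto
  next
    case (2 p)
    then show ?thesis using assms(2) by (intro that) auto
  qed
qed

text \<open>
  The combinatorics of the two trees depends only on the extensions having a common length at each
  stage; that they avoid nowhere dense sets enters only at the very end.
\<close>

locale fusion =
  fixes ext :: "nat \<Rightarrow> nat list set \<Rightarrow> nat list \<Rightarrow> nat list"
    and len :: "nat \<Rightarrow> nat list set \<Rightarrow> nat"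
  assumes prefix_ext: "finite V \<Longrightarrow> v \<in> V \<Longrightarrow> prefix v (ext n V v)"
    and length_ext: "finite V \<Longrightarrow> v \<in> V \<Longrightarrow> length (ext n V v) = len n V"
begin

text \<open>
  The second argument \<open>A\<close> in \<open>sprouts n A A\<close> gives the members of the spine both of their new
  successors and leaves out the other nodes.
\<close>

fun stage :: "nat \<Rightarrow> nat list set \<times> nat list set" where
  "stage 0 = ({[]}, {[]})"
| "stage (Suc n) = (let (A, B) = stage n; V = sprouts n A B
     in (ext n V ` sprouts n A A, B \<union> ext n V ` V))"

definition spine :: "nat \<Rightarrow> nat list set" where "spine n = fst (stage n)"
definition nodes :: "nat \<Rightarrow> nat list set" where "nodes n = snd (stage n)"
definition buds :: "nat \<Rightarrow> nat list set" where "buds n = sprouts n (spine n) (nodes n)"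
definition grow :: "nat \<Rightarrow> nat list \<Rightarrow> nat list" where "grow n = ext n (buds n)"

fun level :: "nat \<Rightarrow> nat" where
  "level 0 = 0"
| "level (Suc n) = len n (buds n)"

definition miller :: "nat list set" where
  "miller = {\<sigma>. \<exists>n. \<exists>t\<in>nodes n. prefix \<sigma> t}"
definition perfect :: "nat list set" where
  "perfect = {\<sigma>. \<exists>n. \<exists>p\<in>spine n. prefix \<sigma> p}"

lemma spine_0: "spine 0 = {[]}" and nodes_0: "nodes 0 = {[]}"
  by (simp_all add: spine_def nodes_def)

lemma spine_Suc: "spine (Suc n) = grow n ` sprouts n (spine n) (spine n)"
  and nodes_Suc: "nodes (Suc n) = nodes n \<union> grow n ` buds n"
  by (simp_all add: spine_def nodes_def buds_def grow_def Let_def case_prod_beta)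

lemma spine_subset_nodes: "spine n \<subseteq> nodes n"
proof (induction n)
  case 0
  then show ?case by (simp add: spine_0 nodes_0)
next
  case (Suc n)
  then have "sprouts n (spine n) (spine n) \<subseteq> buds n"
    unfolding buds_def by (rule sprouts_mono)
  then show ?case by (auto simp: spine_Suc nodes_Suc)
qed

lemma spine_sprouts_subset_buds: "sprouts n (spine n) (spine n) \<subseteq> buds n"
  unfolding buds_def by (rule sprouts_mono[OF spine_subset_nodes])

lemma finite_nodes: "finite (nodes n)"
proof (induction n)
  case (Suc n)
  then have "finite (spine n)" using spine_subset_nodes finite_subset by blast
  then show ?case using Suc by (simp add: nodes_Suc buds_def finite_sprouts)
qed (simp add: nodes_0)

lemma finite_buds: "finite (buds n)"
  unfolding buds_def
  using finite_nodes spine_subset_nodes finite_subset finite_sprouts by metis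

lemma prefix_grow: "v \<in> buds n \<Longrightarrow> prefix v (grow n v)"
  and length_grow: "v \<in> buds n \<Longrightarrow> length (grow n v) = level (Suc n)"
  by (simp_all add: grow_def prefix_ext length_ext finite_buds)

lemma budsE:
  assumes "v \<in> buds n"
  obtains u b where "v = u @ [b]" "u \<in> nodes n" "b div 2 = n"
  using sproutsE[OF assms[unfolded buds_def] spine_subset_nodes] .

lemma length_spine: "p \<in> spine n \<Longrightarrow> length p = level n"
  by (cases n)
    (use spine_sprouts_subset_buds length_grow in \<open>auto simp: spine_0 spine_Suc simp del: level.simps(2)\<close>)

lemma spine_nonempty: "spine n \<noteq> {}"
  by (induction n) (auto simp: spine_0 spine_Suc sprouts_def)

lemma level_strict_mono: "strict_mono level"
proof (rule strict_mono_Suc_iff[THEN iffD2, rule_format])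
  fix n
  obtain p where p: "p \<in> spine n" using spine_nonempty by blast
  then have v: "p @ [2 * n] \<in> buds n"
    using spine_sprouts_subset_buds by (auto simp: sprouts_def)
  show "level n < level (Suc n)"
    using prefix_length_le[OF prefix_grow[OF v]] length_grow[OF v] length_spine[OF p] by simp
qed

lemma nodes_mono: "m \<le> n \<Longrightarrow> nodes m \<subseteq> nodes n"
  by (rule lift_Suc_mono_le) (auto simp: nodes_Suc)

lemma nodes_cases:
  assumes "t \<in> nodes m"
  obtains "t = []" | n v where "v \<in> buds n" "t = grow n v"
  using assms by (induction m) (auto simp: nodes_0 nodes_Suc)

section \<open>The Miller tree\<close>

lemma nodes_subset_miller: "t \<in> nodes n \<Longrightarrow> t \<in> miller"
  by (auto simp: miller_def)

lemma prefix_miller: "\<sigma> \<in> miller \<Longrightarrow> prefix \<rho> \<sigma> \<Longrightarrow> \<rho> \<in> miller"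
  unfolding miller_def using prefix_order.trans by blast

lemma prefix_perfect: "\<sigma> \<in> perfect \<Longrightarrow> prefix \<rho> \<sigma> \<Longrightarrow> \<rho> \<in> perfect"
  unfolding perfect_def using prefix_order.trans by blast

lemma perfect_subset_miller: "perfect \<subseteq> miller"
  unfolding perfect_def miller_def using spine_subset_nodes by blast

lemma infinite_succs_node:
  assumes "t \<in> nodes m"
  shows "infinite (succs miller t)"
proof -
  have "2 * n \<in> succs miller t" if "m \<le> n" for n
  proof -
    have v: "t @ [2 * n] \<in> buds n"
      using assms nodes_mono[OF that] by (auto simp: buds_def sprouts_def)
    then have "grow n (t @ [2 * n]) \<in> nodes (Suc n)" by (simp add: nodes_Suc)
    then show ?thesis
      using prefix_grow[OF v] by (auto simp: succs_def miller_def)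
  qed
  then have "(\<lambda>n. 2 * n) ` {m..} \<subseteq> succs miller t" by auto
  moreover have "infinite ((\<lambda>n::nat. 2 * n) ` {m..})"
    by (subst finite_image_iff) (auto simp: inj_on_def infinite_Ici)
  ultimately show ?thesis using finite_subset by blast
qed

lemma miller_tree_miller: "miller_tree miller"
  unfolding miller_tree_def is_tree_def
proof (intro conjI ballI allI)
  show "miller \<noteq> {}" using nodes_subset_miller[of "[]" 0] by (auto simp: nodes_0)
  show "take n \<sigma> \<in> miller" if "\<sigma> \<in> miller" for \<sigma> n
    using prefix_miller[OF that take_is_prefix] .
  show "\<exists>\<tau>\<in>omega_split_nodes miller. prefix \<sigma> \<tau>" if "\<sigma> \<in> miller" for \<sigma>
    using that infinite_succs_node nodes_subset_miller
    unfolding omega_split_nodes_def miller_def[THEN eqset_imp_iff] by auto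
qed

section \<open>The uniformly perfect tree\<close>

lemma spine_split:
  assumes "p \<in> spine n"
  shows "p \<in> split_nodes perfect"
proof -
  have "b \<in> succs perfect p" if "b \<in> {2 * n, 2 * n + 1}" for b
  proof -
    have v: "p @ [b] \<in> sprouts n (spine n) (spine n)"
      using that assms by (auto simp: sprouts_def)
    then have "grow n (p @ [b]) \<in> spine (Suc n)" by (simp add: spine_Suc)
    moreover have "prefix (p @ [b]) (grow n (p @ [b]))"
      using prefix_grow v spine_sprouts_subset_buds by blast
    ultimately show ?thesis by (auto simp: succs_def perfect_def)
  qed
  then have "{2 * n, 2 * n + 1} \<subseteq> succs perfect p" by blast
  then have "infinite (succs perfect p) \<or> card (succs perfect p) \<ge> 2"
    using card_mono[of "succs perfect p" "{2 * n, 2 * n + 1}"] by auto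
  moreover have "p \<in> perfect" using assms by (auto simp: perfect_def)
  ultimately show ?thesis by (simp add: split_nodes_def)
qed

lemma take_spine:
  assumes "p \<in> spine m" "n \<le> m"
  shows "take (level n) p \<in> spine n"
  using assms
proof (induction m arbitrary: p)
  case 0
  then show ?case by (simp add: spine_0)
next
  case (Suc m)
  show ?case
  proof (cases "n = Suc m")
    case True
    then show ?thesis using Suc.prems length_spine by (metis order_refl take_all)
  next
    case False
    then have nm: "n \<le> m" using Suc.prems by simp
    obtain v where v: "v \<in> sprouts m (spine m) (spine m)" "p = grow m v"
      using Suc.prems by (auto simp: spine_Suc)
    obtain u b where u: "v = u @ [b]" "u \<in> spine m"
      using sproutsE[OF v(1) order_refl] by blast
    have "prefix u p"
      using prefix_grow[of v m] v u spine_sprouts_subset_buds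
      by (metis append_prefixD subsetD)
    moreover have "level n \<le> length u"
      using length_spine[OF u(2)] strict_mono_less_eq[OF level_strict_mono] nm by simp
    ultimately have "take (level n) p = take (level n) u" by (auto simp: prefix_def)
    then show ?thesis using Suc.IH[OF u(2) nm] by simp
  qed
qed

lemma perfect_extends_to_spine:
  assumes "\<sigma> \<in> perfect" "length \<sigma> \<le> level n"
  obtains p where "p \<in> spine n" "prefix \<sigma> p"
proof -
  obtain m p where p: "p \<in> spine m" "prefix \<sigma> p"
    using assms(1) by (auto simp: perfect_def)
  show ?thesis
  proof (cases "n \<le> m")
    case True
    have "prefix \<sigma> (take (level n) p)"
      using p(2) assms(2) by (auto simp: prefix_def)
    then show ?thesis using take_spine[OF p(1) True] that by blast
  next
    case False
    have "\<exists>q\<in>spine (m + k). prefix p q" for k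
    proof (induction k)
      case 0
      then show ?case using p by auto
    next
      case (Suc k)
      then obtain q where q: "q \<in> spine (m + k)" "prefix p q" by blast
      define v where "v = q @ [2 * (m + k)]"
      have v: "v \<in> sprouts (m + k) (spine (m + k)) (spine (m + k))"
        using q by (auto simp: sprouts_def v_def)
      then have "prefix v (grow (m + k) v)"
        using prefix_grow spine_sprouts_subset_buds by blast
      then have "prefix p (grow (m + k) v)"
        using q(2) unfolding v_def by (metis append_prefixD prefix_order.trans)
      moreover have "grow (m + k) v \<in> spine (m + Suc k)"
        using v by (simp add: spine_Suc)
      ultimately show ?case by blast
    qed
    from this[of "n - m"] obtain q where q: "q \<in> spine n" "prefix p q"
      using False by auto
    then show ?thesis using that[OF q(1)] prefix_order.trans[OF p(2) q(2)] by simp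
  qed
qed

text \<open>
  Strictly between two consecutive levels a node already contains a full sprout of the lower spine,
  and the sprout determines the one member of the upper spine that lies above it.
\<close>

lemma split_at_level:
  assumes "\<sigma> \<in> split_nodes perfect"
  shows "\<exists>n. length \<sigma> = level n"
proof (rule ccontr)
  assume no: "\<nexists>n. length \<sigma> = level n"
  define n where "n = (GREATEST n. level n \<le> length \<sigma>)"
  have bound: "\<forall>n. level n \<le> length \<sigma> \<longrightarrow> n \<le> length \<sigma>"
    using strict_mono_imp_increasing[OF level_strict_mono] order_trans by blast
  have "level n \<le> length \<sigma>"
    unfolding n_def
    using GreatestI_nat[of "\<lambda>n. level n \<le> length \<sigma>" 0 "length \<sigma>"] bound by simp
  moreover have "\<not> level (Suc n) \<le> length \<sigma>"
    using Greatest_le_nat[of "\<lambda>n. level n \<le> length \<sigma>" "Suc n" "length \<sigma>"] bound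
    unfolding n_def by fastforce
  ultimately have n: "level n < length \<sigma>" "length \<sigma> < level (Suc n)"
    using no by (metis le_neq_implies_less, metis not_le)
  \<comment> \<open>The member \<open>q\<close> reached through \<open>a\<close> is given by a term in which \<open>a\<close> does not occur.\<close>
  have step: "\<exists>q\<in>spine (Suc n). prefix (\<sigma> @ [a]) q \<and> q = grow n (take (Suc (level n)) \<sigma>)"
    if "a \<in> succs perfect \<sigma>" for a
  proof -
    have mem: "\<sigma> @ [a] \<in> perfect" using that by (simp add: succs_def)
    obtain q where q: "q \<in> spine (Suc n)" "prefix (\<sigma> @ [a]) q"
      by (rule perfect_extends_to_spine[of "\<sigma> @ [a]" "Suc n"])
        (use mem n in \<open>auto simp del: level.simps\<close>)
    obtain v where v: "v \<in> sprouts n (spine n) (spine n)" "q = grow n v"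
      using q by (auto simp: spine_Suc)
    obtain u b where u: "v = u @ [b]" "u \<in> spine n"
      using sproutsE[OF v(1) order_refl] by blast
    have len: "length v = Suc (level n)" using u length_spine by simp
    have "prefix v q" using v prefix_grow spine_sprouts_subset_buds by blast
    moreover have "prefix \<sigma> q" using q append_prefixD by blast
    ultimately have "prefix v \<sigma>" using len n prefix_length_prefix[of v q \<sigma>] by simp
    then have "v = take (Suc (level n)) \<sigma>" using len by (auto simp: prefix_def)
    then show ?thesis using q v by blast
  qed
  have one: "a = b" if "a \<in> succs perfect \<sigma>" "b \<in> succs perfect \<sigma>" for a b
  proof -
    let ?q = "grow n (take (Suc (level n)) \<sigma>)"
    have "prefix (\<sigma> @ [a]) ?q" "prefix (\<sigma> @ [b]) ?q" using step that by auto
    then show ?thesis by (auto simp: prefix_def)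
  qed
  have fin: "finite (succs perfect \<sigma>)"
  proof (cases "succs perfect \<sigma> = {}")
    case False
    then obtain a where "a \<in> succs perfect \<sigma>" by blast
    then have "succs perfect \<sigma> \<subseteq> {a}" using one by blast
    then show ?thesis using finite_subset by blast
  qed simp
  then have "card (succs perfect \<sigma>) \<le> Suc 0" using card_le_Suc0_iff_eq one by blast
  then show False using assms fin by (simp add: split_nodes_def)
qed

lemma level_split:
  assumes "\<sigma> \<in> perfect" "length \<sigma> = level n"
  shows "\<sigma> \<in> split_nodes perfect"
proof -
  obtain p where p: "p \<in> spine n" "prefix \<sigma> p"
    by (rule perfect_extends_to_spine[of \<sigma> n]) (use assms in auto)
  then have "\<sigma> = p" using assms(2) length_spine[OF p(1)] by (auto simp: prefix_def)
  then show ?thesis using p spine_split by blast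
qed

lemma uniformly_perfect_tree_perfect: "uniformly_perfect_tree perfect"
  unfolding uniformly_perfect_tree_def perfect_tree_def is_tree_def
proof (intro conjI ballI allI)
  have "[] \<in> perfect" unfolding perfect_def using spine_0 by blast
  then show "perfect \<noteq> {}" by blast
  show "take n \<sigma> \<in> perfect" if "\<sigma> \<in> perfect" for \<sigma> n
    using prefix_perfect[OF that take_is_prefix] .
  show "\<exists>\<tau>\<in>split_nodes perfect. prefix \<sigma> \<tau>" if "\<sigma> \<in> perfect" for \<sigma>
    using that spine_split unfolding perfect_def[THEN eqset_imp_iff] by auto
  show "{\<sigma>. length \<sigma> = k} \<inter> perfect \<subseteq> split_nodes perfect \<or>
      {\<sigma>. length \<sigma> = k} \<inter> split_nodes perfect = {}" for k
  proof (cases "\<exists>n. k = level n")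
    case True
    then show ?thesis using level_split by blast
  next
    case False
    then have "{\<sigma>. length \<sigma> = k} \<inter> split_nodes perfect = {}"
      using split_at_level by auto
    then show ?thesis by blast
  qed
qed

section \<open>Pairs of branches\<close>

text \<open>
  A member of the Miller tree may lie in the middle of the long stretch from a node \<open>u\<close> to a node
  \<open>t\<close> grown from a sprout \<open>u @ [b]\<close>. If the nodes on \<open>y\<close> were shorter than \<open>K\<close>, then only finitely
  many stretches could be involved, since \<open>u @ [b]\<close> would have to be one of the first \<open>K\<close> nonempty
  initial segments of \<open>y\<close>, and \<open>b\<close> gives the stage and hence the length of \<open>t\<close>. So initial segments
  of \<open>y\<close> beyond a certain length could not belong to the tree.
\<close>

lemma body_miller_passes_long_nodes:
  assumes "y \<in> body miller"
  shows "\<exists>m. \<exists>t\<in>nodes m. y \<in> cyl t \<and> K \<le> length t"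
proof (rule ccontr)
  assume "\<not> ?thesis"
  then have short: "\<And>m t. t \<in> nodes m \<Longrightarrow> y \<in> cyl t \<Longrightarrow> length t < K" by force
  \<comment> \<open>The sum bounds the lengths of all nodes grown from a sprout on \<open>y\<close> shorter than \<open>Suc K\<close>.\<close>
  define k where "k = Suc K + (\<Sum>i<K. level (Suc (y i div 2)))"
  have k: "level (Suc (y i div 2)) < k" if "i < K" for i
    using member_le_sum[of i "{..<K}" "\<lambda>i. level (Suc (y i div 2))"] that
    by (simp add: k_def del: level.simps)
  let ?P = "\<lambda>t. (\<exists>m. t \<in> nodes m) \<and> prefix (restr y k) t"
  have "restr y k \<in> miller" using assms by (simp add: body_def)
  then have "\<exists>t. ?P t" by (auto simp: miller_def)
  \<comment> \<open>By minimality the parent \<open>u\<close> of \<open>t\<close> does not extend \<open>restr y k\<close>, so \<open>u\<close> and its sprout lie on \<open>y\<close>.\<close>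
  from ex_has_least_nat[of ?P, where m = length, OF someI_ex[OF this]]
  obtain t m where t: "t \<in> nodes m" "prefix (restr y k) t"
    and least: "\<And>t' m'. t' \<in> nodes m' \<Longrightarrow> prefix (restr y k) t' \<Longrightarrow> length t \<le> length t'"
    by blast
  have len: "k \<le> length t" using prefix_length_le[OF t(2)] by simp
  from t(1) show False
  proof (cases rule: nodes_cases)
    case 1
    then show False using len by (simp add: k_def)
  next
    case (2 n v)
    obtain u b where u: "v = u @ [b]" "u \<in> nodes n" "b div 2 = n"
      using budsE[OF 2(1)] by blast
    have v: "prefix (u @ [b]) t" using prefix_grow 2 u by auto
    then have ut: "length u < length t" using prefix_length_le by fastforce
    have "prefix u (restr y k)"
      using prefix_same_cases[OF t(2) append_prefixD[OF v]] least[OF u(2)] ut by auto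
    moreover have "u \<noteq> restr y k" using least[OF u(2)] ut by auto
    ultimately have "length u < k"
      by (metis length_restr prefix_length_less strict_prefix_def)
    then have "prefix (u @ [b]) (restr y k)"
      using prefix_length_prefix[OF v t(2)] by simp
    then have y: "y \<in> cyl (u @ [b])" using mem_cyl_restr cyl_antimono by blast
    then have "y \<in> cyl u" "y (length u) = b"
      using cyl_antimono[of u "u @ [b]"] by (auto simp: mem_cyl_iff)
    then have "length t < k"
      using k[of "length u"] short[OF u(2)] length_grow[OF 2(1)] 2(2) u(3) by simp
    then show False using len by simp
  qed
qed

lemma body_perfect_passes_spine:
  assumes "x \<in> body perfect"
  shows "restr x (level n) \<in> spine n"
proof -
  have "restr x (level n) \<in> perfect" using assms by (simp add: body_def)
  then obtain p where p: "p \<in> spine n" "prefix (restr x (level n)) p"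
    by (rule perfect_extends_to_spine[of _ n]) auto
  then have "restr x (level n) = p"
    using length_spine[OF p(1)] by (auto simp: prefix_def)
  then show ?thesis using p by simp
qed

text \<open>
  The sprouts \<open>s\<close> and \<open>t\<close> differ because the nodes grown from them do: both have length
  \<open>level (Suc n)\<close>, which exceeds a place where \<open>x\<close> and \<open>y\<close> disagree.
\<close>

lemma separated_late:
  assumes "x \<in> body perfect" "y \<in> body miller" "x \<noteq> y"
  obtains n s t where "N \<le> n" "s \<in> buds n" "t \<in> buds n" "s \<noteq> t"
    "x \<in> cyl (grow n s)" "y \<in> cyl (grow n t)"
proof -
  obtain d where d: "x d \<noteq> y d" using assms(3) by blast
  \<comment> \<open>The first summand makes \<open>r\<close> disagree with \<open>x\<close>; the second makes its stage at least \<open>N\<close>.\<close>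
  obtain m r where r: "r \<in> nodes m" "y \<in> cyl r" "Suc d + level (Suc N) \<le> length r"
    using body_miller_passes_long_nodes[OF assms(2)] by blast
  from r(1) show ?thesis
  proof (cases rule: nodes_cases)
    case 1
    then show ?thesis using r by simp
  next
    case (2 n t)
    have len: "length r = level (Suc n)" using 2 length_grow by simp
    have "N \<le> n" using r(3) len strict_mono_less_eq[OF level_strict_mono, of "Suc N" "Suc n"] by simp
    obtain s where s: "s \<in> sprouts n (spine n) (spine n)" "restr x (level (Suc n)) = grow n s"
      using body_perfect_passes_spine[OF assms(1), of "Suc n"] by (auto simp: spine_Suc simp del: level.simps)
    have "restr x (level (Suc n)) ! d \<noteq> r ! d"
      using d r len by (simp add: mem_cyl_iff del: level.simps)
    then have "s \<noteq> t" using s 2 by auto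
    moreover have "x \<in> cyl (grow n s)" using s(2) mem_cyl_restr by metis
    ultimately show ?thesis
      using that[OF \<open>N \<le> n\<close>] s spine_sprouts_subset_buds 2 r(2) by blast
  qed
qed

end

theorem theorem8:
  fixes G :: "((nat \<Rightarrow> nat) \<times> (nat \<Rightarrow> nat)) set"
  assumes "comeager G"
  shows "\<exists>M P. miller_tree M \<and> uniformly_perfect_tree P \<and> P \<subseteq> M \<and> body P \<times> body M \<subseteq> G \<union> Id"
proof -
  obtain N :: "nat \<Rightarrow> ((nat \<Rightarrow> nat) \<times> (nat \<Rightarrow> nat)) set"
    where N: "\<And>i. nowhere_dense (N i)" "- G = (\<Union>i. N i)"
    using assms by (auto simp: comeager_def meager_def)
  \<comment> \<open>At stage \<open>n\<close> only \<open>N 0, \<dots>, N n\<close> are dealt with, so that finitely many requirements arise.\<close>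
  define good where "good n V e L \<longleftrightarrow> (\<forall>v\<in>V. prefix v (e v) \<and> length (e v) = L) \<and>
      (\<forall>s\<in>V. \<forall>t\<in>V. \<forall>D\<in>N ` {..n}. s \<noteq> t \<longrightarrow> cyl (e s) \<times> cyl (e t) \<inter> D = {})"
    for n :: nat and V :: "nat list set" and e L
  have "\<exists>e L. good n V e L" if "finite V" for n V
    unfolding good_def by (rule uniform_extension) (use that N(1) in auto)
  then have "\<forall>n V. \<exists>e L. finite V \<longrightarrow> good n V e L" by blast
  then obtain ext len where good: "\<And>n V. finite V \<Longrightarrow> good n V (ext n V) (len n V)"
    unfolding choice_iff by blast
  interpret fusion ext len using good by unfold_locales (auto simp: good_def)
  have "(x, y) \<in> G" if xy: "x \<in> body perfect" "y \<in> body miller" "x \<noteq> y" for x y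
  proof -
    have "(x, y) \<notin> N i" for i
    proof -
      obtain n s t where n: "i \<le> n" "s \<in> buds n" "t \<in> buds n" "s \<noteq> t"
          "x \<in> cyl (grow n s)" "y \<in> cyl (grow n t)"
        by (rule separated_late[OF xy])
      then show ?thesis
        using good[OF finite_buds, of n n] unfolding grow_def good_def by blast
    qed
    then show ?thesis using N(2) by blast
  qed
  then have "body perfect \<times> body miller \<subseteq> G \<union> Id" by auto
  then show ?thesis
    using miller_tree_miller uniformly_perfect_tree_perfect perfect_subset_miller by blast
qed

end
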